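(* Let $d,\nu\ge1$ be integers and let $F_1,\ldots,F_d:\mathbb{R}^\nu\to\mathbb{R}$ be continuous functions such that each $F_i$ is periodic in each of its variables with periods $\beta_{i,1},\ldots,\beta_{i,\nu}$, respectively (nonzero reals). Let furthermore $P_1,\ldots,P_d$ and $P_{i,j}$, $1\le i\le d$, $1\le j\le\nu$, be real polynomials in one variable without constant term. If the system $$(P_1,P_{1,1}/\beta_{1,1},\ldots,P_{1,\nu}/\beta_{1,\nu}),\ \ldots,\ (P_d,P_{d,1}/\beta_{d,1},\ldots,P_{d,\nu}/\beta_{d,\nu})$$ is totally $\mathbf{Q}$-independent, then the sequence of vectors $$\Bigl(P_1(n)+F_1\bigl(P_{1,1}(n),\ldots,P_{1,\nu}(n)\bigr),\ \ldots,\ P_d(n)+F_d\bigl(P_{d,1}(n),\ldots,P_{d,\nu}(n)\bigr)\Bigr),\qquad n=1,2,\ldots,$$ is uniformly distributed on $[0,1)^d$ (mod 1).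
   Context: A system $(P_1,P_{1,1},\ldots,P_{1,\nu}),\ldots,(P_d,P_{d,1},\ldots,P_{d,\nu})$ of $(\nu+1)$-tuples of real polynomials is called totally $\mathbf{Q}$-independent if for every non-empty subset $\Lambda\subset\{1,\ldots,d\}$ and all nonzero integers $a_\lambda$, $\lambda\in\Lambda$, the polynomial $\sum_{\lambda\in\Lambda}a_\lambda P_\lambda$ cannot be written as a linear combination with rational coefficients of the polynomials $P_{\lambda,j}$, $\lambda\in\Lambda$, $1\le j\le\nu$, and of a polynomial with integer coefficients (i.e. it is not of the form $\sum_{\lambda\in\Lambda,\,1\le j\le\nu}r_{\lambda,j}P_{\lambda,j}+rR$ with $r_{\lambda,j},r$ rational and $R$ a polynomial with integer coefficients). A sequence $(X_n)_{n\ge1}$ in $\mathbb{R}^d$ is uniformly distributed on $[0,1)^d$ (mod 1) if for all $0\le a_i<b_i<1$ ($1\le i\le d$), $\lim_{n\to\infty}\frac1n\#\{1\le k\le n:\{X_k\}\in\prod_{i=1}^d[a_i,b_i]\}=\prod_{i=1}^d(b_i-a_i)$, where $\{\cdot\}$ is the coordinatewise fractional part. *)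

theory Defs
  imports "HOL-Analysis.Analysis" "HOL-Computational_Algebra.Polynomial"
begin

text \<open>
  Total \<open>Q\<close>-independence of the system of tuples \<open>(P l, Q l j, \<dots>)\<close>, where \<open>l\<close> ranges over the
  finite type \<open>'d\<close> (in place of \<open>1, \<dots>, d\<close>) and \<open>j\<close> over the finite type \<open>'v\<close> (in place of
  \<open>1, \<dots>, \<nu>\<close>). Only the values of \<open>a\<close> and \<open>r\<close> on \<open>L\<close> matter.
\<close>

definition totally_Q_independent ::
  "('d::finite \<Rightarrow> real poly) \<Rightarrow> ('d \<Rightarrow> 'v::finite \<Rightarrow> real poly) \<Rightarrow> bool" where
  "totally_Q_independent P Q \<longleftrightarrow>
    (\<forall>(L :: 'd set) (a :: 'd \<Rightarrow> int). L \<noteq> {} \<longrightarrow> (\<forall>l\<in>L. a l \<noteq> 0) \<longrightarrow>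
      \<not> (\<exists>(r :: 'd \<Rightarrow> 'v \<Rightarrow> rat) (s :: rat) (R :: int poly).
            (\<Sum>l\<in>L. smult (of_int (a l)) (P l)) =
            (\<Sum>l\<in>L. \<Sum>j\<in>UNIV. smult (of_rat (r l j)) (Q l j))
              + smult (of_rat s) (map_poly real_of_int R)))"

text \<open>
  The sequence is \<open>X 1, X 2, \<dots>\<close>; the value \<open>X 0\<close> is ignored. For vectors, \<open>cbox a b\<close> is the
  product of the closed intervals \<open>{a $ i..b $ i}\<close>.
\<close>

definition uniformly_distributed_mod_1 :: "(nat \<Rightarrow> real ^ 'd) \<Rightarrow> bool" where
  "uniformly_distributed_mod_1 X \<longleftrightarrow>
    (\<forall>a b :: real ^ 'd. (\<forall>i. 0 \<le> a $ i \<and> a $ i < b $ i \<and> b $ i < 1) \<longrightarrow>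
      (\<lambda>n. real (card {k \<in> {1..n}. (\<chi> i. frac (X k $ i)) \<in> cbox a b}) / real n)
        \<longlonglongrightarrow> (\<Prod>i\<in>UNIV. b $ i - a $ i))"

end

theory Submission
  imports Defs
begin

text \<open>
  By the Weyl criterion it suffices that, for a nonzero integer vector \<open>h\<close>, the exponential sums of
  \<open>\<Sum>\<^sub>i h\<^sub>i (P\<^sub>i(n) + F\<^sub>i(\<dots>))\<close> have mean value zero. The factor coming from the \<open>F\<^sub>i\<close> is a continuous
  function, periodic with period 1 in each variable, of the values \<open>Q\<^sub>i\<^sub>j(n) / \<beta>\<^sub>i\<^sub>j\<close> with \<open>h\<^sub>i \<noteq> 0\<close>;
  approximating it uniformly by trigonometric polynomials (Stone--Weierstrass on the torus) leaves
  exponential sums of polynomials \<open>\<Sum>\<^sub>i h\<^sub>i P\<^sub>i + \<Sum>\<^sub>i\<^sub>j m\<^sub>i\<^sub>j Q\<^sub>i\<^sub>j / \<beta>\<^sub>i\<^sub>j\<close> with integers \<open>m\<^sub>i\<^sub>j\<close>. Total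
  independence says exactly that such a polynomial has an irrational nonconstant coefficient, so
  that Weyl's theorem applies. The latter follows from van der Corput's inequality by induction on
  the largest index of an irrational coefficient; when this index is 1, the summands are periodic up
  to a constant factor different from 1, and the sums stay bounded.
\<close>

section \<open>Van der Corput and Weyl sums\<close>

abbreviation e :: "real \<Rightarrow> complex" where "e x \<equiv> cis (2 * pi * x)"

definition avg :: "(nat \<Rightarrow> complex) \<Rightarrow> nat \<Rightarrow> complex" where
  "avg u N = (\<Sum>n=1..N. u n) / of_nat N"

lemma e_add: "e (x + y) = e x * e y"
  by (simp add: cis_mult distrib_left)

lemma e_of_int: "x \<in> \<int> \<Longrightarrow> e x = 1"
  by (auto elim!: Ints_cases simp: cis_multiple_2pi)

lemma e_eq_1_imp_Ints:
  assumes "e x = 1"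
  shows "x \<in> \<int>"
proof -
  have "cos (2 * pi * x) = 1" using assms by (metis cis.simps(1) one_complex.simps(1))
  then obtain k :: int where "2 * pi * x = k * 2 * pi"
    by (auto simp: cos_one_2pi_int)
  then have "x = of_int k" by simp
  then show ?thesis by simp
qed

lemma norm_sum_le_card: "(\<And>n. norm (u n :: complex) \<le> B) \<Longrightarrow> norm (\<Sum>n=1..N. u n) \<le> real N * B"
  using sum_norm_bound[of "{1..N}" u B] by simp

lemma norm_avg_le:
  assumes "\<And>n. norm (u n) \<le> B"
  shows "norm (avg u N) \<le> B"
proof (cases "N = 0")
  case True
  then show ?thesis using order_trans[OF norm_ge_zero assms] by (simp add: avg_def)
next
  case False
  then show ?thesis using norm_sum_le_card[of u B N, OF assms]
    by (simp add: avg_def norm_divide field_simps)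
qed

lemma avg_add: "avg (\<lambda>n. u n + v n) N = avg u N + avg v N"
  and avg_diff: "avg (\<lambda>n. u n - v n) N = avg u N - avg v N"
  and avg_cmult: "avg (\<lambda>n. c * u n) N = c * avg u N"
  and avg_cnj: "avg (\<lambda>n. cnj (u n)) N = cnj (avg u N)"
  by (simp_all add: avg_def sum.distrib sum_subtractf add_divide_distrib diff_divide_distrib
      sum_distrib_left)

lemma avg_sum: "avg (\<lambda>n. \<Sum>i\<in>I. u i n) N = (\<Sum>i\<in>I. avg (u i) N)"
  unfolding avg_def by (subst sum.swap) (simp add: sum_divide_distrib)

lemma avg_const: "avg (\<lambda>n. c) \<longlonglongrightarrow> c"
proof (rule tendsto_eventually)
  show "\<forall>\<^sub>F N in sequentially. avg (\<lambda>n. c) N = c"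
    using eventually_gt_at_top[of 0] by eventually_elim (simp add: avg_def)
qed

text \<open>The mean is a contraction for the sup norm, so the limit passes through uniform
  approximation. The limit \<open>m\<close> of the approximant's means may vary with
  \<open>\<epsilon>\<close>, as long as it approaches \<open>l\<close>.\<close>

lemma tendsto_avg_approx:
  assumes "\<And>\<epsilon>. \<epsilon> > 0 \<Longrightarrow> \<exists>v m. avg v \<longlonglongrightarrow> m \<and> (\<forall>n. norm (u n - v n) \<le> \<epsilon>) \<and> norm (l - m) \<le> \<epsilon>"
  shows "avg u \<longlonglongrightarrow> l"
proof (rule tendstoI)
  fix \<epsilon> :: real assume "\<epsilon> > 0"
  then obtain v m where v: "avg v \<longlonglongrightarrow> m" "\<And>n. norm (u n - v n) \<le> \<epsilon>/4" "norm (l - m) \<le> \<epsilon>/4"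
    using assms[of "\<epsilon>/4"] by auto
  have "\<forall>\<^sub>F N in sequentially. dist (avg v N) m < \<epsilon>/4"
    by (rule tendstoD[OF v(1)]) (use \<open>\<epsilon> > 0\<close> in simp)
  then show "\<forall>\<^sub>F N in sequentially. dist (avg u N) l < \<epsilon>"
  proof eventually_elim
    case (elim N)
    have "norm (avg u N - avg v N) \<le> \<epsilon>/4"
      using norm_avg_le[OF v(2)] by (simp add: avg_diff)
    then have "dist (avg u N) (avg v N) \<le> \<epsilon>/4" "dist m l \<le> \<epsilon>/4"
      using v(3) by (simp_all add: dist_norm norm_minus_commute)
    then show ?case
      using elim dist_triangle[of "avg u N" l "avg v N"] dist_triangle[of "avg v N" l m]
        \<open>\<epsilon> > 0\<close> by linarith
  qed
qed

section \<open>Shifted sums and van der Corput's difference theorem\<close>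

lemma sum_shift_bound:
  assumes "\<And>n. norm (u n :: complex) \<le> 1"
  shows "norm ((\<Sum>n=1..N. u (n + h)) - (\<Sum>n=1..N. u n)) \<le> 2 * real h"
proof (induction h)
  case (Suc h)
  \<comment> \<open>Moving the window by one place gains one term and loses one, at a cost of at
    most 2.\<close>
  have "(\<Sum>n=1..N. u (n + Suc h)) - (\<Sum>n=1..N. u (n + h)) = u (Suc N + h) - u (1 + h)"
    by (induction N) (auto simp: algebra_simps)
  also have "norm \<dots> \<le> 2"
    using norm_triangle_ineq4[of "u (Suc N + h)" "u (1 + h)"] assms[of "Suc N + h"]
      assms[of "1 + h"] by linarith
  finally have "norm ((\<Sum>n=1..N. u (n + Suc h)) - (\<Sum>n=1..N. u (n + h))) \<le> 2" .
  from norm_triangle_le[OF add_mono[OF this Suc.IH]] show ?case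
    by (simp add: algebra_simps)
qed simp

lemma tendsto_avg_shift:
  assumes "\<And>n. norm (u n) \<le> 1" "avg u \<longlonglongrightarrow> l"
  shows "avg (\<lambda>n. u (n + h)) \<longlonglongrightarrow> l"
proof -
  have "(\<lambda>N. avg (\<lambda>n. u (n + h)) N - avg u N) \<longlonglongrightarrow> 0"
  proof (rule Lim_null_comparison)
    show "(\<lambda>N. 2 * real h / real N) \<longlonglongrightarrow> 0"
      by (rule lim_const_over_n)
    show "\<forall>\<^sub>F N in sequentially. norm (avg (\<lambda>n. u (n + h)) N - avg u N) \<le> 2 * real h / real N"
      using sum_shift_bound[of u, OF assms(1)]
      by (intro always_eventually allI)
        (simp add: avg_def norm_divide divide_right_mono del: One_nat_def flip: diff_divide_distrib)
  qed
  from tendsto_add[OF this assms(2)] show ?thesis by simp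
qed

theorem van_der_Corput:
  fixes u :: "nat \<Rightarrow> complex"
  assumes u: "\<And>n. norm (u n) = 1"
    and corr: "\<And>h. h > 0 \<Longrightarrow> avg (\<lambda>n. u (n + h) * cnj (u n)) \<longlonglongrightarrow> 0"
  shows "avg u \<longlonglongrightarrow> 0"
proof -
  \<comment> \<open>Up to \<open>O(H\<^sup>2 / N)\<close>, \<open>H\<close> times the mean of \<open>u\<close> is the mean of the block sums \<open>S H\<close>, whose mean
    square tends to \<open>H\<close>.\<close>
  define S where "S H n = (\<Sum>h<H. u (n + h))" for H n
  \<comment> \<open>For \<open>j < i\<close>, shifting by \<open>j\<close> reduces the correlation
    to that of lag \<open>i - j\<close>; conjugation exchanges the two indices.\<close>
  have pair: "avg (\<lambda>n. u (n + i) * cnj (u (n + j))) \<longlonglongrightarrow> of_bool (i = j)" for i j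
  proof -
    have gt: "avg (\<lambda>n. u (n + i) * cnj (u (n + j))) \<longlonglongrightarrow> 0" if "j < i" for i j
      using tendsto_avg_shift[OF _ corr[of "i - j"], of j] that by (simp add: norm_mult u)
    consider "i = j" | "j < i" | "i < j" by linarith
    then show ?thesis
    proof cases
      case 1
      have "u (n + j) * cnj (u (n + j)) = 1" for n
        by (simp add: complex_norm_square[symmetric] u)
      then show ?thesis using 1 avg_const[of 1] by simp
    next
      case 2
      then show ?thesis using gt by simp
    next
      case 3
      have "(\<lambda>N. cnj (avg (\<lambda>n. u (n + j) * cnj (u (n + i))) N)) \<longlonglongrightarrow> cnj 0"
        by (intro tendsto_cnj gt 3)
      then show ?thesis using 3 by (simp add: avg_cnj[symmetric] mult.commute)
    qed
  qed
  have S_lim: "avg (\<lambda>n. of_real ((norm (S H n))\<^sup>2)) \<longlonglongrightarrow> of_nat H" for H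
  proof -
    have "of_real ((norm (S H n))\<^sup>2) = (\<Sum>i<H. \<Sum>j<H. u (n + i) * cnj (u (n + j)))" for n
      unfolding complex_norm_square S_def by (simp add: sum_product)
    moreover have "(\<lambda>N. \<Sum>i<H. \<Sum>j<H. avg (\<lambda>n. u (n + i) * cnj (u (n + j))) N)
        \<longlonglongrightarrow> (\<Sum>i<H. \<Sum>j<H. of_bool (i = j))"
      by (intro tendsto_sum pair)
    moreover have "avg (\<lambda>n. \<Sum>i<H. \<Sum>j<H. u (n + i) * cnj (u (n + j))) =
        (\<lambda>N. \<Sum>i<H. \<Sum>j<H. avg (\<lambda>n. u (n + i) * cnj (u (n + j))) N)"
      by (rule ext) (simp add: avg_sum)
    ultimately show ?thesis by (simp add: of_bool_def)
  qed
  \<comment> \<open>Each of the \<open>H\<close> shifted sums differs from the unshifted one by at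
    most \<open>2 * H\<close>; Cauchy-Schwarz then passes from the sum of \<open>S H\<close> to its
    mean square.\<close>
  have bound: "H * norm (avg u N) \<le> sqrt (norm (avg (\<lambda>n. of_real ((norm (S H n))\<^sup>2)) N)) + 2 * real H * H / N"
    if "N > 0" for H N
  proof -
    have "norm ((\<Sum>n=1..N. S H n) - of_nat H * (\<Sum>n=1..N. u n))
        = norm (\<Sum>h<H. (\<Sum>n=1..N. u (n + h)) - (\<Sum>n=1..N. u n))"
      unfolding S_def by (subst sum.swap) (simp add: sum_subtractf)
    also have "\<dots> \<le> (\<Sum>h<H. 2 * real H)"
      by (intro sum_norm_le order_trans[OF sum_shift_bound]) (auto simp: u)
    finally have d: "norm ((\<Sum>n=1..N. S H n) - of_nat H * (\<Sum>n=1..N. u n)) \<le> 2 * real H * H"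
      by (simp add: mult_ac)
    define A where "A = (\<Sum>n=1..N. (norm (S H n))\<^sup>2)"
    have "norm (\<Sum>n=1..N. S H n)^2 \<le> (\<Sum>n=1..N. norm (S H n))\<^sup>2"
      by (intro power_mono norm_sum) auto
    also have "\<dots> \<le> N * A"
      unfolding A_def using sum_squared_le_sum_of_squares[of "\<lambda>n. norm (S H n)" "{1..N}"] by (simp add: mult.commute)
    finally have s: "norm (\<Sum>n=1..N. S H n) \<le> sqrt (N * A)"
      by (simp add: real_le_rsqrt)
    have A: "norm (avg (\<lambda>n. of_real ((norm (S H n))\<^sup>2)) N) = A / N"
    proof -
      have "A \<ge> 0" unfolding A_def by (intro sum_nonneg) auto
      then show ?thesis
        unfolding avg_def of_real_sum[symmetric] A_def[symmetric] by (simp add: norm_divide)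
    qed
    have "H * norm (\<Sum>n=1..N. u n) \<le> sqrt (N * A) + 2 * real H * H"
      using norm_triangle_ineq3[of "of_nat H * (\<Sum>n=1..N. u n)" "\<Sum>n=1..N. S H n"] d s
      by (simp add: norm_mult norm_minus_commute)
    then have "H * norm (avg u N) \<le> (sqrt (N * A) + 2 * real H * H) / N"
      using that by (simp add: avg_def norm_divide divide_right_mono)
    also have "\<dots> = sqrt (A / N) + 2 * real H * H / N"
    proof -
      have "sqrt (N * A) / N = sqrt (A / N)"
        using that by (simp add: real_sqrt_mult real_sqrt_divide field_simps)
      then show ?thesis by (simp add: add_divide_distrib)
    qed
    finally show ?thesis unfolding A .
  qed
  show ?thesis
  proof (rule tendstoI)
    fix \<epsilon> :: real assume "\<epsilon> > 0"
    \<comment> \<open>For large \<open>N\<close> the bound is close to \<open>sqrt H\<close>, which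
      lies below \<open>H * \<epsilon>\<close> as soon as \<open>H\<close> exceeds
      \<open>1 / \<epsilon>\<^sup>2\<close>.\<close>
    obtain H :: nat where H: "H > 0" "1 / real H < \<epsilon>\<^sup>2"
      using real_arch_inverse[of "\<epsilon>\<^sup>2"] \<open>\<epsilon> > 0\<close> by (auto simp: inverse_eq_divide)
    have "(\<lambda>N. sqrt (norm (avg (\<lambda>n. of_real ((norm (S H n))\<^sup>2)) N)) + 2 * real H * H / N)
       \<longlonglongrightarrow> sqrt (norm (of_nat H :: complex)) + 0"
      by (intro tendsto_add tendsto_real_sqrt tendsto_norm S_lim lim_const_over_n)
    moreover have "sqrt (norm (of_nat H :: complex)) + 0 < H * \<epsilon>"
    proof -
      have "1 < real H * \<epsilon>\<^sup>2" using H by (simp add: field_simps)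
      then have "real H * 1 < real H * (real H * \<epsilon>\<^sup>2)" using H by (intro mult_strict_left_mono) auto
      then have "real H < (H * \<epsilon>)\<^sup>2" by (simp add: power2_eq_square mult_ac)
      then show ?thesis using \<open>\<epsilon> > 0\<close> by (simp add: real_less_lsqrt)
    qed
    ultimately have "\<forall>\<^sub>F N in sequentially.
        sqrt (norm (avg (\<lambda>n. of_real ((norm (S H n))\<^sup>2)) N)) + 2 * real H * H / N < H * \<epsilon>"
      by (rule order_tendstoD)
    then show "\<forall>\<^sub>F N in sequentially. dist (avg u N) 0 < \<epsilon>"
      using eventually_gt_at_top[of 0]
    proof eventually_elim
      case (elim N)
      then have "H * norm (avg u N) < H * \<epsilon>" using bound[of N H] by linarith
      then show ?case using H by simp
    qed
  qed
qed

section \<open>Weyl sums of real polynomials\<close>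

lemma common_denominator:
  fixes f :: "'a \<Rightarrow> real"
  assumes "finite A" "\<And>a. a \<in> A \<Longrightarrow> f a \<in> \<rat>"
  obtains D :: nat where "D > 0" "\<And>a. a \<in> A \<Longrightarrow> real D * f a \<in> \<int>"
proof -
  have "\<exists>D::nat. D > 0 \<and> (\<forall>a\<in>A. real D * f a \<in> \<int>)"
    using assms
  proof (induction rule: finite_induct)
    case empty
    then show ?case by (intro exI[of _ 1]) auto
  next
    case (insert x A)
    then obtain D :: nat where D: "D > 0" "\<forall>a\<in>A. real D * f a \<in> \<int>" by auto
    obtain m :: int and n :: nat where mn: "f x = m / n" "n > 0"
      using insert.prems[of x] by (auto simp: Rats_eq_int_div_nat)
    have "real (D * n) * f x = of_int (int D * m)" using mn by simp
    moreover have "real (D * n) * f a = of_nat n * (real D * f a)" for a by simp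
    ultimately have "\<forall>a\<in>insert x A. real (D * n) * f a \<in> \<int>"
      using D(2) by (metis Ints_mult Ints_of_int Ints_of_nat insert_iff)
    then show ?case using D(1) mn(2) by (intro exI[of _ "D * n"]) auto
  qed
  then show ?thesis using that by blast
qed

text \<open>Binomial expansion of each power of \<open>x + h\<close>; the term \<open>j = i\<close>
  cancels against \<open>p\<close>. Only coefficients of index above \<open>i\<close> survive, so
  differencing lowers the largest index of an irrational coefficient by one.\<close>

lemma coeff_pcompose_shift_diff:
  fixes p :: "real poly"
  shows "coeff (pcompose p [:h, 1:] - p) i =
    (\<Sum>j\<in>{i<..degree p}. coeff p j * (real (j choose i) * h ^ (j - i)))"
proof -
  have "pcompose p [:h, 1:] = (\<Sum>j\<le>degree p. smult (coeff p j) ([:h, 1:] ^ j))"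
    unfolding pcompose_altdef poly_altdef
    by (simp add: degree_map_poly coeff_map_poly)
  moreover have "coeff ([:h, 1:] ^ j) i = real (j choose i) * h ^ (j - i)" for j
  proof (cases "i \<le> j")
    case True
    then show ?thesis by (simp add: coeff_linear_poly_power)
  next
    case False
    then have "coeff ([:h, 1:] ^ j) i = 0"
      by (intro coeff_eq_0) (simp add: degree_linear_power)
    then show ?thesis using False by (simp add: binomial_eq_0)
  qed
  ultimately have "coeff (pcompose p [:h, 1:]) i
      = (\<Sum>j\<le>degree p. coeff p j * (real (j choose i) * h ^ (j - i)))"
    by (simp add: coeff_sum)
  also have "\<dots> = (\<Sum>j\<in>{i..degree p}. coeff p j * (real (j choose i) * h ^ (j - i)))"
    by (intro sum.mono_neutral_right) (auto simp: binomial_eq_0)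
  also have "\<dots> = coeff p i + (\<Sum>j\<in>{i<..degree p}. coeff p j * (real (j choose i) * h ^ (j - i)))"
    by (cases "i \<le> degree p") (auto simp: coeff_eq_0 sum.head)
  finally show ?thesis by simp
qed

text \<open>Let \<open>D\<close> clear the denominators of the coefficients of index at least 2.
  Modulo 1, the step from \<open>n\<close> to \<open>n + D\<close> adds the constant
  \<open>coeff p 1 * D\<close>, which is irrational, so the summands are multiplied by a fixed
  \<open>\<omega>\<close> different from 1.\<close>

lemma weyl_sum_linear:
  fixes p :: "real poly"
  assumes irr: "coeff p 1 \<notin> \<rat>" and rat: "\<And>i. i > 1 \<Longrightarrow> coeff p i \<in> \<rat>"
  shows "avg (\<lambda>n. e (poly p (real n))) \<longlonglongrightarrow> 0"
proof -
  obtain D :: nat where D: "D > 0" "\<And>i. i \<in> {2..degree p} \<Longrightarrow> real D * coeff p i \<in> \<int>"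
    using common_denominator[of "{2..degree p}" "coeff p"] rat by auto
  have Ints: "poly p (real (n + D)) - poly p (real n) - coeff p 1 * D \<in> \<int>" for n :: nat
  proof -
    have 1: "degree p \<ge> 1" using irr by (metis le_degree Rats_0)
    have "poly p (real (n + D)) - poly p (real n) = (\<Sum>i\<le>degree p. coeff p i * (real (n + D) ^ i - real n ^ i))"
      by (simp add: poly_altdef sum_subtractf algebra_simps)
    also have "\<dots> = coeff p 1 * D + (\<Sum>i\<in>{..degree p} - {1}. coeff p i * (real (n + D) ^ i - real n ^ i))"
      using 1 by (subst sum.remove[of _ 1]) auto
    finally have "poly p (real (n + D)) - poly p (real n) - coeff p 1 * D
      = (\<Sum>i\<in>{..degree p} - {1}. coeff p i * (real (n + D) ^ i - real n ^ i))" by simp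
    moreover have "coeff p i * (real (n + D) ^ i - real n ^ i) \<in> \<int>"
      if i: "i \<in> {..degree p} - {1}" for i
    proof (cases "i = 0")
      case False
      then have "real D * coeff p i \<in> \<int>" using D(2)[of i] i by auto
      \<comment> \<open>The factor \<open>D\<close> of this difference of powers is what clears the
        denominator of the coefficient.\<close>
      moreover have "int D dvd int (n + D) ^ i - int n ^ i"
        by (subst mod_eq_dvd_iff[symmetric]) (metis mod_add_self2 of_nat_add power_mod)
      then obtain z where "int (n + D) ^ i - int n ^ i = int D * z" by (elim dvdE)
      then have "real (n + D) ^ i - real n ^ i = real D * of_int z"
        by (metis of_int_diff of_int_mult of_int_of_nat_eq of_int_power)
      then have "coeff p i * (real (n + D) ^ i - real n ^ i) = (real D * coeff p i) * of_int z"
        by simp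
      ultimately show ?thesis by (metis Ints_mult Ints_of_int)
    qed simp
    ultimately show ?thesis by (metis (no_types, lifting) Ints_sum)
  qed
  define \<omega> where "\<omega> = e (coeff p 1 * D)"
  have shift: "e (poly p (real (n + D))) = \<omega> * e (poly p (real n))" for n :: nat
  proof -
    have "e (poly p (real (n + D))) = e ((poly p (real (n + D)) - poly p (real n) - coeff p 1 * D) + (coeff p 1 * D + poly p (real n)))"
      by (simp add: algebra_simps)
    also have "\<dots> = \<omega> * e (poly p (real n))"
      unfolding e_add \<omega>_def using e_of_int[OF Ints] by simp
    finally show ?thesis .
  qed
  have "\<omega> \<noteq> 1"
  proof
    assume "\<omega> = 1"
    then have "coeff p 1 * D \<in> \<rat>"
      unfolding \<omega>_def using e_eq_1_imp_Ints Ints_subset_Rats by blast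
    then have "coeff p 1 * D / D \<in> \<rat>" by (intro Rats_divide) auto
    then show False using irr D(1) by simp
  qed
  \<comment> \<open>Multiplication by \<open>\<omega> - 1\<close> turns the sum into the shifted sum
    minus the sum, which is at most \<open>2 * D\<close> whatever \<open>N\<close> is.\<close>
  have *: "norm (\<Sum>n=1..N. e (poly p (real n))) \<le> 2 * real D / norm (\<omega> - 1)" for N
  proof -
    have "(\<omega> - 1) * (\<Sum>n=1..N. e (poly p (real n))) = (\<Sum>n=1..N. e (poly p (real (n + D)))) - (\<Sum>n=1..N. e (poly p (real n)))"
      unfolding shift by (simp add: sum_distrib_left left_diff_distrib sum_subtractf)
    then have "norm (\<omega> - 1) * norm (\<Sum>n=1..N. e (poly p (real n))) \<le> 2 * real D"
      using sum_shift_bound[of "\<lambda>n. e (poly p (real n))" D N] by (simp add: norm_mult[symmetric])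
    then show ?thesis using \<open>\<omega> \<noteq> 1\<close> by (simp add: field_simps)
  qed
  show ?thesis
  proof (rule Lim_null_comparison)
    show "(\<lambda>N. 2 * real D / norm (\<omega> - 1) / real N) \<longlonglongrightarrow> 0"
      by (rule lim_const_over_n)
    show "\<forall>\<^sub>F N in sequentially. norm (avg (\<lambda>n. e (poly p (real n))) N) \<le> 2 * real D / norm (\<omega> - 1) / real N"
      using * by (intro always_eventually allI)
        (simp add: avg_def norm_divide divide_right_mono del: divide_divide_eq_left)
  qed
qed

lemma weyl_sum_Suc:
  fixes p :: "real poly"
  assumes "coeff p (Suc k) \<notin> \<rat>" "\<And>i. i > Suc k \<Longrightarrow> coeff p i \<in> \<rat>"
  shows "avg (\<lambda>n. e (poly p (real n))) \<longlonglongrightarrow> 0"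
  using assms
proof (induction k arbitrary: p)
  case 0
  then show ?case by (intro weyl_sum_linear) auto
next
  case (Suc k)
  show ?case
  proof (rule van_der_Corput)
    fix h :: nat assume h: "h > 0"
    \<comment> \<open>The correlation of lag \<open>h\<close> is the exponential of the differenced
      polynomial \<open>q\<close>, whose largest index of an irrational coefficient is
      \<open>Suc k\<close>.\<close>
    define q where "q = pcompose p [:real h, 1:] - p"
    have q: "coeff q i = (\<Sum>j\<in>{i<..degree p}. coeff p j * (real (j choose i) * real h ^ (j - i)))" for i
      unfolding q_def by (rule coeff_pcompose_shift_diff)
    have rat: "coeff p j * (real (j choose i) * real h ^ (j - i)) \<in> \<rat>" if "j > Suc (Suc k)" for i j
      using Suc.prems(2)[OF that] by (intro Rats_mult Rats_power) auto
    have "coeff q i \<in> \<rat>" if "i > Suc k" for i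
      unfolding q using that by (intro Rats_sum rat) auto
    moreover have "coeff q (Suc k) \<notin> \<rat>"
    proof
      assume "coeff q (Suc k) \<in> \<rat>"
      moreover have "degree p \<ge> Suc (Suc k)" using Suc.prems(1) by (metis le_degree Rats_0)
      \<comment> \<open>The first term carries the irrational coefficient times the nonzero integer
        \<open>Suc (Suc k) * h\<close>; all later terms are rational.\<close>
      then have "{Suc k<..degree p} = insert (Suc (Suc k)) {Suc (Suc k)<..degree p}" by auto
      then have "coeff q (Suc k) = coeff p (Suc (Suc k)) * (real (Suc (Suc k)) * h)
        + (\<Sum>j\<in>{Suc (Suc k)<..degree p}. coeff p j * (real (j choose Suc k) * real h ^ (j - Suc k)))"
        unfolding q by simp
      moreover have "(\<Sum>j\<in>{Suc (Suc k)<..degree p}. coeff p j * (real (j choose Suc k) * real h ^ (j - Suc k))) \<in> \<rat>"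
        by (intro Rats_sum rat) auto
      ultimately have "coeff p (Suc (Suc k)) * (real (Suc (Suc k)) * h) \<in> \<rat>"
        by (metis Rats_diff add_diff_cancel_right')
      then have "coeff p (Suc (Suc k)) * (real (Suc (Suc k)) * h) / (real (Suc (Suc k)) * h) \<in> \<rat>"
        by (rule Rats_divide) (intro Rats_mult Rats_of_nat)
      moreover have "real (Suc (Suc k)) * real h \<noteq> 0" using h by simp
      ultimately show False using Suc.prems(1) by (metis nonzero_mult_div_cancel_right)
    qed
    ultimately have "avg (\<lambda>n. e (poly q (real n))) \<longlonglongrightarrow> 0"
      by (intro Suc.IH)
    moreover have "e (poly q (real n)) = e (poly p (real (n + h))) * cnj (e (poly p (real n)))" for n :: nat
      by (simp add: q_def poly_pcompose cis_cnj cis_mult algebra_simps)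
    ultimately show "avg (\<lambda>n. e (poly p (real (n + h))) * cnj (e (poly p (real n)))) \<longlonglongrightarrow> 0" by simp
  qed simp
qed

theorem weyl_sum:
  fixes p :: "real poly"
  assumes "coeff p k \<notin> \<rat>" "k > 0"
  shows "avg (\<lambda>n. e (poly p (real n))) \<longlonglongrightarrow> 0"
proof -
  let ?K = "{k. coeff p k \<notin> \<rat>}"
  have sub: "?K \<subseteq> {..degree p}" by (auto intro: le_degree)
  then have fin: "finite ?K" by (rule finite_subset) simp
  define m where "m = Max ?K"
  have "m \<in> ?K" unfolding m_def using assms(1) fin by (intro Max_in) auto
  moreover have "k \<le> m" unfolding m_def using assms(1) fin by (intro Max_ge) auto
  moreover have "coeff p i \<in> \<rat>" if "i > m" for i
    using Max_ge[OF fin, of i] that unfolding m_def by auto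
  ultimately show ?thesis using assms(2) weyl_sum_Suc[of p "m - 1"] by simp
qed

section \<open>Trigonometric approximation of periodic functions\<close>

definition charac :: "int ^ 'n \<Rightarrow> real ^ 'n::finite \<Rightarrow> complex" where
  "charac m x = e (\<Sum>j\<in>UNIV. of_int (m $ j) * x $ j)"

text \<open>Generating these functions from scaled characters by addition avoids finite sets of
  frequencies and makes every linear statement a rule induction.\<close>

inductive trig :: "(real ^ 'n::finite \<Rightarrow> complex) \<Rightarrow> bool" where
  charac: "trig (\<lambda>x. c * charac m x)"
| add: "trig f \<Longrightarrow> trig g \<Longrightarrow> trig (\<lambda>x. f x + g x)"

lemma charac_add: "charac (m + m') x = charac m x * charac m' x"
  by (simp add: charac_def distrib_right sum.distrib e_add[symmetric])

lemma charac_axis: "charac (axis j k) x = e (of_int k * x $ j)"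
proof -
  have "(\<Sum>i\<in>UNIV. of_int (axis j k $ i) * x $ i) = (\<Sum>i\<in>UNIV. if i = j then of_int k * x $ j else 0)"
    by (intro sum.cong) (auto simp: axis_def)
  then show ?thesis by (simp add: charac_def)
qed

lemma continuous_on_charac [continuous_intros]: "continuous_on A (charac m)"
  unfolding charac_def by (intro continuous_intros)

lemma trig_const: "trig (\<lambda>x. c)"
  using trig.charac[of c 0] by (simp add: charac_def)

lemma trig_mult_charac:
  assumes "trig f"
  shows "trig (\<lambda>x. (c * charac m x) * f x)"
  using assms
proof induction
  case (charac d m')
  show ?case using trig.charac[of "c * d" "m + m'"] by (simp add: charac_add mult_ac)
next
  case (add f g)
  then show ?case by (simp add: distrib_left trig.add)
qed

lemma trig_mult: "trig f \<Longrightarrow> trig g \<Longrightarrow> trig (\<lambda>x. f x * g x)"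
  by (induction rule: trig.induct) (auto simp: distrib_right intro: trig_mult_charac trig.add)

lemma trig_cmult: "trig f \<Longrightarrow> trig (\<lambda>x. c * f x)"
  by (intro trig_mult trig_const)

lemma trig_sum: "finite I \<Longrightarrow> (\<And>i. i \<in> I \<Longrightarrow> trig (f i)) \<Longrightarrow> trig (\<lambda>x. \<Sum>i\<in>I. f i x)"
  by (induction rule: finite_induct) (auto intro: trig_const trig.add)

section \<open>Periodic functions as functions on the torus\<close>

definition torus_map :: "real ^ 'n::finite \<Rightarrow> complex ^ 'n" where
  "torus_map x = (\<chi> j. e (x $ j))"

definition torus :: "(complex ^ 'n::finite) set" where
  "torus = {z. \<forall>j. norm (z $ j) = 1}"

lemma continuous_on_torus_map: "continuous_on A torus_map"
  unfolding torus_map_def by (intro continuous_intros)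

lemma torus_map_image: "torus_map ` cbox 0 1 = (torus :: (complex ^ 'n::finite) set)"
proof
  show "torus_map ` cbox 0 1 \<subseteq> (torus :: (complex ^ 'n) set)"
    by (auto simp: torus_map_def torus_def)
  show "(torus :: (complex ^ 'n) set) \<subseteq> torus_map ` cbox 0 1"
  proof
    fix z :: "complex ^ 'n" assume z: "z \<in> torus"
    define x :: "real ^ 'n" where "x = (\<chi> j. Arg2pi (z $ j) / (2 * pi))"
    have "e (x $ j) = z $ j" for j
    proof -
      have "norm (z $ j) = 1" using z by (simp add: torus_def)
      then have "cis (Arg2pi (z $ j)) = z $ j"
        by (metis Arg2pi_eq cis_conv_exp mult_1 of_real_1)
      then show ?thesis by (simp add: x_def)
    qed
    then have xz: "torus_map x = z" by (simp add: torus_map_def vec_eq_iff)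
    have "0 \<le> x $ j \<and> x $ j \<le> 1" for j
      using Arg2pi[of "z $ j"] by (simp add: x_def)
    then have "x \<in> cbox 0 1" by (simp add: mem_box_cart)
    then show "z \<in> torus_map ` cbox 0 1" using xz by blast
  qed
qed

text \<open>A real-linear functional is a combination of the real and imaginary parts of the
  coordinates. On the torus these are cosines and sines, hence combinations of characters of
  frequency 1 and -1; sums and products stay within \<open>trig\<close>.\<close>

lemma trig_real_polynomial_function:
  fixes p :: "complex ^ 'n::finite \<Rightarrow> real"
  assumes "real_polynomial_function p"
  shows "trig (\<lambda>x. of_real (p (torus_map x)))"
  using assms
proof induction
  case (linear f)
  have f: "f z = (\<Sum>j\<in>UNIV. Re (z $ j) * f (axis j 1) + Im (z $ j) * f (axis j \<i>))" for z
  proof -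
    interpret bounded_linear f by fact
    have "z = (\<Sum>j\<in>UNIV. Re (z $ j) *\<^sub>R axis j 1 + Im (z $ j) *\<^sub>R axis j \<i>)"
    proof (subst vec_eq_iff, intro allI)
      fix i
      have "(\<Sum>j\<in>UNIV. Re (z $ j) *\<^sub>R axis j 1 + Im (z $ j) *\<^sub>R axis j \<i>) $ i
         = (\<Sum>j\<in>UNIV. if j = i then complex_of_real (Re (z $ i)) + \<i> * complex_of_real (Im (z $ i)) else 0)"
        unfolding sum_component by (intro sum.cong refl) (simp add: axis_def complex_eq_iff)
      also have "\<dots> = z $ i" by (simp add: complex_eq[symmetric])
      finally show "z $ i = (\<Sum>j\<in>UNIV. Re (z $ j) *\<^sub>R axis j 1 + Im (z $ j) *\<^sub>R axis j \<i>) $ i" ..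
    qed
    then have "f z = f (\<Sum>j\<in>UNIV. Re (z $ j) *\<^sub>R axis j 1 + Im (z $ j) *\<^sub>R axis j \<i>)" by simp
    also have "\<dots> = (\<Sum>j\<in>UNIV. Re (z $ j) * f (axis j 1) + Im (z $ j) * f (axis j \<i>))"
      by (simp add: sum add scaleR)
    finally show ?thesis .
  qed
  have cis: "complex_of_real (cos t) = (cis t + cis (- t)) / 2"
    "complex_of_real (sin t) = (cis t - cis (- t)) / (2 * \<i>)" for t
    by (simp_all add: complex_eq_iff)
  have tc: "trig (\<lambda>x. cis (2 * pi * x $ j))" "trig (\<lambda>x. cis (- (2 * pi * x $ j)))" for j :: 'n
    using trig.charac[of 1 "axis j 1"] trig.charac[of 1 "axis j (- 1)"]
    by (simp_all add: charac_axis)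
  have trig_cos: "trig (\<lambda>x. complex_of_real (cos (2 * pi * x $ j)))" for j :: 'n
    using trig_cmult[OF trig.add[OF tc], of "1 / 2"] unfolding cis by simp
  have trig_sin: "trig (\<lambda>x. complex_of_real (sin (2 * pi * x $ j)))" for j :: 'n
    using trig_cmult[OF trig.add[OF tc(1) trig_cmult[OF tc(2), of "- 1"]], of "1 / (2 * \<i>)"]
    unfolding cis by simp
  have "(\<lambda>x. complex_of_real (f (torus_map x))) = (\<lambda>x. \<Sum>j\<in>UNIV.
      complex_of_real (cos (2 * pi * x $ j)) * of_real (f (axis j 1))
      + complex_of_real (sin (2 * pi * x $ j)) * of_real (f (axis j \<i>)))"
    by (rule ext, subst f) (simp add: torus_map_def)
  then show ?case
    by (auto intro!: trig_sum trig.add trig_mult trig_const trig_cos trig_sin)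
next
  case (const c)
  then show ?case by (rule trig_const)
next
  case (add f g)
  then show ?case by (simp add: trig.add)
next
  case (mult f g)
  then show ?case by (simp add: trig_mult)
qed

lemma periodic_int_translate:
  fixes f :: "real ^ 'n::finite \<Rightarrow> 'a"
  assumes per: "\<And>j x. f (x + axis j 1) = f x"
  shows "f (x + (\<chi> j. of_int (k j))) = f x"
proof -
  have nat: "f (x + axis j (of_nat n)) = f x" for j x and n :: nat
  proof (induction n)
    case (Suc n)
    have "axis j (of_nat (Suc n)) = axis j (of_nat n) + axis j (1 :: real)"
      by (simp add: vec_eq_iff axis_def)
    then show ?case using per[of "x + axis j (of_nat n)" j] Suc by (simp add: add.assoc)
  next
    case 0
    have "axis j (0 :: real) = 0" by (simp add: vec_eq_iff axis_def)
    then show ?case by (simp only: of_nat_0 add_0_right)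
  qed
  have int: "f (x + axis j (of_int i)) = f x" for j x and i :: int
  proof (cases "i \<ge> 0")
    case True
    then show ?thesis using nat[of x j "nat i"] by simp
  next
    case False
    have "x + axis j (of_int i) + axis j (of_nat (nat (- i))) = x"
      using False by (simp add: vec_eq_iff axis_def)
    then show ?thesis using nat[of "x + axis j (of_int i)" j "nat (- i)"] by (simp only:)
  qed
  have "f (x + (\<Sum>j\<in>J. axis j (of_int (k j)))) = f x" if "finite J" for J
    using that
  proof (induction J rule: finite_induct)
    case (insert j J)
    then show ?case
      using int[of "x + (\<Sum>j\<in>J. axis j (of_int (k j)))" j "k j"] by (simp add: algebra_simps)
  qed simp
  then have "f (x + (\<Sum>j\<in>UNIV. axis j (of_int (k j)))) = f x" by simp
  moreover have "(\<Sum>j\<in>UNIV. axis j (of_int (k j))) = (\<chi> j. real_of_int (k j))"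
    by (simp add: vec_eq_iff axis_def)
  ultimately show ?thesis by (simp only:)
qed

text \<open>By periodicity \<open>f\<close> factors through \<open>torus_map\<close> as a continuous
  function \<open>G\<close> on the compact torus. Stone-Weierstrass approximates \<open>G\<close> by
  polynomials in the real coordinates, which pull back to trigonometric polynomials.\<close>

theorem trig_approximation:
  fixes f :: "real ^ 'n::finite \<Rightarrow> complex"
  assumes cont: "continuous_on UNIV f" and per: "\<And>j x. f (x + axis j 1) = f x" and "\<epsilon> > 0"
  obtains g where "trig g" "\<And>x. norm (f x - g x) < \<epsilon>"
proof -
  \<comment> \<open>An arbitrary section of \<open>torus_map\<close> suffices: two preimages of a
    point differ by an integer vector, where \<open>f\<close> takes the same value.\<close>
  define r :: "complex ^ 'n \<Rightarrow> real ^ 'n" where "r z = (SOME x. x \<in> cbox 0 1 \<and> torus_map x = z)" for z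
  define G where "G z = f (r z)" for z
  have G: "G (torus_map x) = f x" for x
  proof -
    have "torus_map x \<in> torus" by (simp add: torus_map_def torus_def)
    then have "\<exists>y. y \<in> cbox 0 1 \<and> torus_map y = torus_map x"
      unfolding torus_map_image[symmetric] by auto
    then have eq: "torus_map (r (torus_map x)) = torus_map x"
      unfolding r_def by (rule someI2_ex) simp
    have "r (torus_map x) $ j - x $ j \<in> \<int>" for j
    proof -
      have "e (r (torus_map x) $ j) = e (x $ j)"
        using eq by (simp add: torus_map_def vec_eq_iff)
      then have "e (r (torus_map x) $ j - x $ j) = 1"
        by (simp add: right_diff_distrib cis_divide[symmetric])
      then show ?thesis by (rule e_eq_1_imp_Ints)
    qed
    then have "\<forall>j. \<exists>k. r (torus_map x) $ j - x $ j = of_int k"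
      by (auto elim: Ints_cases)
    from choice[OF this] obtain k where k: "\<And>j. r (torus_map x) $ j - x $ j = of_int (k j)"
      by blast
    have "r (torus_map x) = x + (\<chi> j. of_int (k j))"
      using k by (simp add: vec_eq_iff algebra_simps)
    then have "f (r (torus_map x)) = f (x + (\<chi> j. of_int (k j)))" by (rule arg_cong)
    also have "\<dots> = f x" by (rule periodic_int_translate[of f, OF per])
    finally show ?thesis unfolding G_def .
  qed
  have "continuous_on torus G"
    unfolding continuous_on_closed_invariant
  proof (intro allI impI)
    \<comment> \<open>Although \<open>r\<close> may jump, the preimage of \<open>C\<close> under
      \<open>G\<close> is the image under \<open>torus_map\<close> of a compact part of the unit
      cube, hence closed.\<close>
    fix C :: "complex set" assume "closed C"
    have "compact (cbox 0 1 \<inter> f -` C)"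
      using \<open>closed C\<close> cont
      by (intro compact_Int_closed compact_cbox continuous_closed_vimage)
        (auto simp: continuous_on_eq_continuous_at)
    then have "closed (torus_map ` (cbox 0 1 \<inter> f -` C))"
      by (intro compact_imp_closed compact_continuous_image continuous_on_torus_map)
    moreover have "torus_map ` (cbox 0 1 \<inter> f -` C) \<inter> torus = G -` C \<inter> torus"
    proof -
      have "cbox 0 1 \<inter> f -` C = cbox 0 1 \<inter> torus_map -` (G -` C)" by (simp add: vimage_def G)
      then show ?thesis unfolding torus_map_image[symmetric] by blast
    qed
    ultimately show "\<exists>A. closed A \<and> A \<inter> torus = G -` C \<inter> torus" by blast
  qed
  moreover have "compact (torus :: (complex ^ 'n) set)"
    unfolding torus_map_image[symmetric]
    by (intro compact_continuous_image continuous_on_torus_map compact_cbox)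
  ultimately obtain p where p: "polynomial_function p" "\<And>z. z \<in> torus \<Longrightarrow> norm (G z - p z) < \<epsilon>"
    using Stone_Weierstrass_polynomial_function[of torus G \<epsilon>] \<open>\<epsilon> > 0\<close> by metis
  define g where "g x = p (torus_map x)" for x
  have "g = (\<lambda>x. of_real ((Re \<circ> p) (torus_map x)) + \<i> * of_real ((Im \<circ> p) (torus_map x)))"
    by (rule ext) (simp add: g_def complex_eq[symmetric])
  moreover have "real_polynomial_function (Re \<circ> p)" "real_polynomial_function (Im \<circ> p)"
    using p(1) bounded_linear_Re bounded_linear_Im unfolding polynomial_function_def by blast+
  ultimately have "trig g"
    by (auto intro!: trig.add trig_cmult trig_real_polynomial_function simp del: o_apply)
  moreover have "norm (f x - g x) < \<epsilon>" for x
    using p(2)[of "torus_map x"] G[of x] by (simp add: g_def torus_map_def torus_def)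
  ultimately show ?thesis using that by blast
qed

section \<open>Weyl sums of the perturbed sequence\<close>

text \<open>The claim is linear in \<open>f\<close>, so it holds for trigonometric polynomials; the
  weights have norm at most 1 and do not enlarge the error of approximation.\<close>

lemma avg_periodic_null:
  fixes y :: "nat \<Rightarrow> real ^ 'n::finite"
  assumes w: "\<And>n. norm (w n) \<le> 1"
    and null: "\<And>m. avg (\<lambda>n. charac m (y n) * w n) \<longlonglongrightarrow> 0"
    and f: "continuous_on UNIV f" "\<And>j x. f (x + axis j 1) = f x"
  shows "avg (\<lambda>n. f (y n) * w n) \<longlonglongrightarrow> 0"
proof (rule tendsto_avg_approx)
  fix \<epsilon> :: real assume "\<epsilon> > 0"
  then obtain g where g: "trig g" "\<And>x. norm (f x - g x) < \<epsilon>"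
    using trig_approximation[OF f] by metis
  from g(1) have "avg (\<lambda>n. g (y n) * w n) \<longlonglongrightarrow> 0"
  proof induction
    case (charac c m)
    have "avg (\<lambda>n. c * charac m (y n) * w n) = (\<lambda>N. c * avg (\<lambda>n. charac m (y n) * w n) N)"
      by (rule ext) (simp add: avg_cmult[symmetric] mult.assoc)
    then show ?case using tendsto_mult_right_zero[OF null] by simp
  next
    case (add f g)
    have "avg (\<lambda>n. (f (y n) + g (y n)) * w n) =
        (\<lambda>N. avg (\<lambda>n. f (y n) * w n) N + avg (\<lambda>n. g (y n) * w n) N)"
      by (rule ext) (simp add: avg_add[symmetric] distrib_right)
    then show ?case using tendsto_add[OF add.IH] by simp
  qed
  moreover have "norm (f (y n) * w n - g (y n) * w n) \<le> \<epsilon>" for n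
  proof -
    have "norm (f (y n) * w n - g (y n) * w n) = norm (f (y n) - g (y n)) * norm (w n)"
      by (simp add: norm_mult[symmetric] left_diff_distrib)
    also have "\<dots> \<le> \<epsilon> * 1"
      using g(2)[of "y n"] w[of n] \<open>\<epsilon> > 0\<close> by (intro mult_mono) auto
    finally show ?thesis by simp
  qed
  ultimately show "\<exists>v m. avg v \<longlonglongrightarrow> m \<and> (\<forall>n. norm (f (y n) * w n - v n) \<le> \<epsilon>) \<and> norm (0 - m) \<le> \<epsilon>"
    using \<open>\<epsilon> > 0\<close> by (intro exI[of _ "\<lambda>n. g (y n) * w n"] exI[of _ 0]) auto
qed

section \<open>Irrational coefficients from total independence\<close>

lemma rational_poly_eq_smult_int_poly:
  fixes p :: "real poly"
  assumes "\<And>k. coeff p k \<in> \<rat>"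
  obtains s :: rat and R :: "int poly" where "p = smult (of_rat s) (map_poly real_of_int R)"
proof -
  obtain D :: nat where D: "D > 0" "\<And>k. k \<in> {..degree p} \<Longrightarrow> real D * coeff p k \<in> \<int>"
    using common_denominator[of "{..degree p}" "coeff p"] assms by auto
  \<comment> \<open>With \<open>s = 1 / D\<close>; the coefficients of \<open>D * p\<close> are
    already integers, and \<open>floor\<close> only changes their type.\<close>
  define R where "R = map_poly floor (smult (real D) p)"
  have "p = smult (of_rat (1 / of_nat D)) (map_poly real_of_int R)"
  proof (rule poly_eqI)
    fix k
    have "real D * coeff p k \<in> \<int>" using D(2)[of k] by (cases "k \<le> degree p") (auto simp: coeff_eq_0)
    then have "real_of_int \<lfloor>real D * coeff p k\<rfloor> = real D * coeff p k" by simp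
    then show "coeff p k = coeff (smult (of_rat (1 / of_nat D)) (map_poly real_of_int R)) k"
      using D(1) unfolding R_def by (simp add: coeff_map_poly of_rat_divide del: of_int_floor_cancel)
  qed
  then show ?thesis using that by blast
qed

text \<open>With rational coefficients only, the polynomial would be a rational multiple of an
  integer polynomial; moving the \<open>Q\<close>-terms to the other side, with
  \<open>r = - m\<close>, contradicts independence. Vanishing constant terms exclude
  \<open>k = 0\<close>.\<close>

lemma totally_Q_independent_imp_irrational_coeff:
  fixes P :: "'d::finite \<Rightarrow> real poly" and Q :: "'d \<Rightarrow> 'v::finite \<Rightarrow> real poly"
    and a :: "'d \<Rightarrow> int" and m :: "'d \<Rightarrow> 'v \<Rightarrow> int"
  assumes indep: "totally_Q_independent P Q"
    and P0: "\<And>i. coeff (P i) 0 = 0" and Q0: "\<And>i j. coeff (Q i j) 0 = 0"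
    and L: "L \<noteq> {}" "\<And>l. l \<in> L \<Longrightarrow> a l \<noteq> 0"
  obtains k where "k > 0"
    "coeff ((\<Sum>l\<in>L. smult (of_int (a l)) (P l)) + (\<Sum>l\<in>L. \<Sum>j\<in>UNIV. smult (of_int (m l j)) (Q l j))) k \<notin> \<rat>"
proof -
  let ?p = "(\<Sum>l\<in>L. smult (of_int (a l)) (P l)) + (\<Sum>l\<in>L. \<Sum>j\<in>UNIV. smult (of_int (m l j)) (Q l j))"
  have "\<exists>k. coeff ?p k \<notin> \<rat>"
  proof (rule ccontr)
    assume "\<not> ?thesis"
    then have "coeff ?p k \<in> \<rat>" for k by (simp only: not_ex not_not)
    from rational_poly_eq_smult_int_poly[of ?p, OF this]
    obtain s R where sR: "?p = smult (of_rat s) (map_poly real_of_int R)" .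
    define r :: "'d \<Rightarrow> 'v \<Rightarrow> rat" where "r l j = of_int (- m l j)" for l j
    have *: "(\<Sum>l\<in>L. \<Sum>j\<in>UNIV. smult (of_rat (r l j)) (Q l j))
        = - (\<Sum>l\<in>L. \<Sum>j\<in>UNIV. smult (of_int (m l j)) (Q l j))"
      by (simp add: r_def of_rat_minus sum_negf)
    have lin: "x = - y + z" if "x + y = z" for x y z :: "real poly"
      using that by (simp add: algebra_simps)
    have eq: "(\<Sum>l\<in>L. smult (of_int (a l)) (P l)) =
       (\<Sum>l\<in>L. \<Sum>j\<in>UNIV. smult (of_rat (r l j)) (Q l j)) + smult (of_rat s) (map_poly real_of_int R)"
      unfolding * by (rule lin[OF sR])
    have "\<not> (\<exists>(r :: 'd \<Rightarrow> 'v \<Rightarrow> rat) (s :: rat) (R :: int poly). (\<Sum>l\<in>L. smult (of_int (a l)) (P l)) =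
       (\<Sum>l\<in>L. \<Sum>j\<in>UNIV. smult (of_rat (r l j)) (Q l j)) + smult (of_rat s) (map_poly real_of_int R))"
      by (rule indep[unfolded totally_Q_independent_def, THEN spec, of L, THEN spec, of a, THEN mp,
            OF L(1), THEN mp]) (use L(2) in blast)
    then show False
      by (rule notE) (intro exI[of _ r] exI[of _ s] exI[of _ R] eq)
  qed
  then obtain k where k: "coeff ?p k \<notin> \<rat>" ..
  moreover have "coeff ?p 0 = 0" by (simp add: coeff_sum P0 Q0)
  ultimately have "k > 0" by (cases "k = 0") simp_all
  then show ?thesis using k by (rule that)
qed

theorem perturbed_weyl_sum:
  fixes F :: "'d::finite \<Rightarrow> real ^ 'v::finite \<Rightarrow> real"
    and \<beta> :: "'d \<Rightarrow> 'v \<Rightarrow> real"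
    and P :: "'d \<Rightarrow> real poly"
    and Q :: "'d \<Rightarrow> 'v \<Rightarrow> real poly"
  assumes cont: "\<And>i. continuous_on UNIV (F i)"
    and \<beta>: "\<And>i j. \<beta> i j \<noteq> 0"
    and per: "\<And>i j x. F i (x + axis j (\<beta> i j)) = F i x"
    and P0: "\<And>i. coeff (P i) 0 = 0"
    and Q0: "\<And>i j. coeff (Q i j) 0 = 0"
    and indep: "totally_Q_independent P (\<lambda>i j. smult (1 / \<beta> i j) (Q i j))"
    and h: "h \<noteq> 0"
  shows "avg (\<lambda>n. charac h (\<chi> i. poly (P i) (real n) + F i (\<chi> j. poly (Q i j) (real n)))) \<longlonglongrightarrow> 0"
proof -
  \<comment> \<open>Independence speaks of sets of indices with nonzero integers \<open>a\<close>,
    so the argument is restricted to the support of \<open>h\<close>.\<close>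
  define L where "L = {i. h $ i \<noteq> 0}"
  have L: "L \<noteq> {}" using h by (auto simp: L_def vec_eq_iff)
  have sumL: "(\<Sum>i\<in>UNIV. of_int (h $ i) * g i) = (\<Sum>i\<in>L. of_int (h $ i) * g i)" for g :: "'d \<Rightarrow> real"
    by (rule sum.mono_neutral_right) (auto simp: L_def)
  \<comment> \<open>The default 0 outside \<open>L\<close> keeps \<open>Q i j\<close> with
    \<open>i\<close> not in \<open>L\<close> out of the characters of \<open>y n\<close>;
    independence for \<open>L\<close> does not control these polynomials.\<close>
  define y :: "nat \<Rightarrow> real ^ ('d \<times> 'v)" where
    "y n = (\<chi> ij. if fst ij \<in> L then poly (Q (fst ij) (snd ij)) (real n) / \<beta> (fst ij) (snd ij) else 0)" for n
  define w where "w n = e (\<Sum>i\<in>L. of_int (h $ i) * poly (P i) (real n))" for n :: nat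
  \<comment> \<open>Rescaling by \<open>\<beta> i j\<close> turns all periods into 1, and
    \<open>F i\<close> and \<open>F l\<close> read disjoint blocks of coordinates for distinct
    \<open>i\<close> and \<open>l\<close>.\<close>
  define G where "G x = e (\<Sum>i\<in>L. of_int (h $ i) * F i (\<chi> j. \<beta> i j * x $ (i, j)))" for x :: "real ^ ('d \<times> 'v)"
  have "avg (\<lambda>n. G (y n) * w n) \<longlonglongrightarrow> 0"
  proof (rule avg_periodic_null)
    show "norm (w n) \<le> 1" for n by (simp add: w_def)
    have "continuous_on UNIV (\<lambda>x :: real ^ ('d \<times> 'v). F i (\<chi> j. \<beta> i j * x $ (i, j)))" for i
      by (rule continuous_on_compose2[OF cont[of i]]) (auto intro!: continuous_intros)
    then show "continuous_on UNIV G"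
      unfolding G_def by (intro continuous_intros)
    show "G (x + axis ij 1) = G x" for ij x
    proof -
      obtain i j where ij: "ij = (i, j)" by fastforce
      have "F l (\<chi> k. \<beta> l k * (x + axis ij 1) $ (l, k)) = F l (\<chi> k. \<beta> l k * x $ (l, k))" for l
      proof (cases "l = i")
        case True
        then have "(\<chi> k. \<beta> l k * (x + axis ij 1) $ (l, k)) = (\<chi> k. \<beta> l k * x $ (l, k)) + axis j (\<beta> l j)"
          by (auto simp: vec_eq_iff axis_def ij distrib_left)
        then show ?thesis by (simp add: per)
      next
        case False
        then show ?thesis by (simp add: axis_def ij)
      qed
      then show ?thesis unfolding G_def by simp
    qed
    show "avg (\<lambda>n. charac m (y n) * w n) \<longlonglongrightarrow> 0" for m
    proof -
      let ?p = "(\<Sum>l\<in>L. smult (of_int (h $ l)) (P l)) +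
        (\<Sum>l\<in>L. \<Sum>j\<in>UNIV. smult (of_int (m $ (l, j))) (smult (1 / \<beta> l j) (Q l j)))"
      obtain k where k: "k > 0" "coeff ?p k \<notin> \<rat>"
        by (rule totally_Q_independent_imp_irrational_coeff[OF indep, of L "\<lambda>l. h $ l" "\<lambda>l j. m $ (l, j)"])
          (use P0 Q0 L in \<open>auto simp: L_def\<close>)
      have "charac m (y n) * w n = e (poly ?p (real n))" for n
      proof -
        have "(\<Sum>ij\<in>UNIV. of_int (m $ ij) * y n $ ij)
            = (\<Sum>i\<in>UNIV. \<Sum>j\<in>UNIV. of_int (m $ (i, j)) * y n $ (i, j))"
          by (simp add: sum.cartesian_product)
        also have "\<dots> = (\<Sum>i\<in>L. \<Sum>j\<in>UNIV. of_int (m $ (i, j)) * (poly (Q i j) (real n) / \<beta> i j))"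
          by (rule sum.mono_neutral_cong_right) (auto simp: y_def)
        finally show ?thesis
          unfolding charac_def w_def e_add[symmetric] by (simp add: poly_sum add.commute)
      qed
      then show ?thesis using weyl_sum[OF k(2,1)] by simp
    qed
  qed
  moreover have "G (y n) * w n = charac h (\<chi> i. poly (P i) (real n) + F i (\<chi> j. poly (Q i j) (real n)))" for n
  proof -
    have "(\<Sum>i\<in>L. of_int (h $ i) * F i (\<chi> j. \<beta> i j * y n $ (i, j)))
        = (\<Sum>i\<in>L. of_int (h $ i) * F i (\<chi> j. poly (Q i j) (real n)))"
      by (intro sum.cong refl) (simp add: y_def \<beta>)
    then show ?thesis
      unfolding G_def w_def charac_def e_add[symmetric] vec_lambda_beta sumL
      by (simp add: sum.distrib[symmetric] distrib_left add.commute)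
  qed
  ultimately show ?thesis by simp
qed

section \<open>The Weyl criterion\<close>

lemma charac_prod: "charac m x = (\<Prod>j\<in>UNIV. e (of_int (m $ j) * x $ j))"
proof -
  have "e (\<Sum>j\<in>J. f j) = (\<Prod>j\<in>J. e (f j))" if "finite J" for J and f :: "'a \<Rightarrow> real"
    using that by (induction rule: finite_induct) (simp_all add: e_add)
  then show ?thesis unfolding charac_def by simp
qed

text \<open>The period is centred at an arbitrary \<open>c\<close> so that it can later be placed
  around the midpoint of a side of the box.\<close>

lemma integral_e:
  fixes m :: int
  shows "integral {c - 1/2..c + 1/2} (\<lambda>x. e (of_int m * x)) = of_bool (m = 0)"
proof (cases "m = 0")
  case False
  define z where "z = 2 * of_real pi * \<i> * of_int m"
  have z: "z \<noteq> 0" using False by (simp add: z_def)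
  have e: "e (of_int m * x) = exp (z * of_real x)" for x
    by (simp add: z_def cis_conv_exp mult_ac)
  have "((\<lambda>x. exp (z * of_real x)) has_integral
      exp (z * of_real (c + 1/2)) / z - exp (z * of_real (c - 1/2)) / z) {c - 1/2..c + 1/2}"
  proof (rule fundamental_theorem_of_calculus)
    fix x
    show "((\<lambda>x. exp (z * of_real x) / z) has_vector_derivative exp (z * of_real x))
        (at x within {c - 1/2..c + 1/2})"
      using z by (intro has_vector_derivative_real_field) (auto intro!: derivative_eq_intros)
  qed simp
  moreover have "exp (z * of_real (c + 1/2)) = exp (z * of_real (c - 1/2))"
  proof -
    have "e (of_int m * (c + 1/2)) = e (of_int m + of_int m * (c - 1/2))"
      by (simp add: algebra_simps)
    also have "\<dots> = e (of_int m * (c - 1/2))"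
      unfolding e_add by simp
    finally show ?thesis unfolding e .
  qed
  ultimately show ?thesis unfolding e using False by (simp add: integral_unique)
qed simp

text \<open>This replaces the characters in one coordinate by any continuous periodic function. The
  weight \<open>w\<close> stands for the factors in the other coordinates and \<open>W\<close> for
  the product of their means.\<close>

lemma avg_periodic_weighted:
  fixes x :: "nat \<Rightarrow> real" and c :: real
  defines "mean \<equiv> \<lambda>f :: real \<Rightarrow> complex. integral {c - 1/2..c + 1/2} f"
  assumes w: "\<And>n. norm (w n) \<le> 1"
    and lim: "\<And>m :: int. avg (\<lambda>n. e (of_int m * x n) * w n) \<longlonglongrightarrow> mean (\<lambda>t. e (of_int m * t)) * W"
    and f: "continuous_on UNIV f" "\<And>t. f (t + 1) = f t"
  shows "avg (\<lambda>n. f (x n) * w n) \<longlonglongrightarrow> mean f * W"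
proof (rule tendsto_avg_approx)
  fix \<epsilon> :: real assume \<epsilon>: "\<epsilon> > 0"
  \<comment> \<open>Uniform error \<open>\<eta>\<close> costs at most \<open>\<eta>\<close> in the
    averages and \<open>\<eta> * norm W\<close> in the limit; both are then at most
    \<open>\<epsilon>\<close>.\<close>
  define \<eta> where "\<eta> = \<epsilon> / (1 + norm W)"
  have "1 + norm W > 0" by (simp add: add_pos_nonneg)
  then have \<eta>: "\<eta> > 0" "\<eta> \<le> \<epsilon>" "\<eta> * norm W \<le> \<epsilon>"
    using \<epsilon> unfolding \<eta>_def
    by (auto simp: field_simps intro: mult_nonneg_nonneg)
  let ?v = "\<lambda>t. (\<chi> _. t) :: real ^ 1"
  have vec: "(v :: real ^ 1) = ?v (v $ 1)" for v
    by (simp add: vec_eq_iff forall_1)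
  obtain g where g: "trig g" "\<And>v. norm (f (v $ (1 :: 1)) - g v) < \<eta>"
  proof (rule trig_approximation[of "\<lambda>v :: real ^ 1. f (v $ 1)" \<eta>])
    show "continuous_on UNIV (\<lambda>v :: real ^ 1. f (v $ 1))"
      by (rule continuous_on_compose2[OF f(1)]) (auto intro!: continuous_intros)
    show "f ((v + axis j 1) $ 1) = f (v $ 1)" for j :: 1 and v :: "real ^ 1"
      using f(2) by (simp add: axis_def)
  qed (use \<eta> in auto)
  define g' where "g' t = g (?v t)" for t
  have approx: "norm (f t - g' t) \<le> \<eta>" for t
    using g(2)[of "?v t"] by (simp add: g'_def)
  have "continuous_on UNIV g' \<and> avg (\<lambda>n. g' (x n) * w n) \<longlonglongrightarrow> mean g' * W"
    unfolding g'_def using g(1)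
  proof induction
    case (charac a m)
    have "charac m (?v t) = e (of_int (m $ 1) * t)" for t
      by (simp add: charac_def)
    moreover have "avg (\<lambda>n. a * e (of_int (m $ 1) * x n) * w n)
        = (\<lambda>N. a * avg (\<lambda>n. e (of_int (m $ 1) * x n) * w n) N)"
      by (rule ext) (simp add: avg_cmult[symmetric] mult.assoc)
    moreover have "(\<lambda>N. a * avg (\<lambda>n. e (of_int (m $ 1) * x n) * w n) N)
        \<longlonglongrightarrow> a * (mean (\<lambda>t. e (of_int (m $ 1) * t)) * W)"
      by (intro tendsto_mult tendsto_const lim)
    ultimately show ?case
      by (auto simp: mean_def mult.assoc intro!: continuous_intros)
  next
    case (add f g)
    have "avg (\<lambda>n. (f (?v (x n)) + g (?v (x n))) * w n) =
        (\<lambda>N. avg (\<lambda>n. f (?v (x n)) * w n) N + avg (\<lambda>n. g (?v (x n)) * w n) N)"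
      by (rule ext) (simp add: avg_add[symmetric] distrib_right)
    moreover have "mean (\<lambda>t. f (?v t) + g (?v t)) = mean (\<lambda>t. f (?v t)) + mean (\<lambda>t. g (?v t))"
      unfolding mean_def using add.IH
      by (intro integral_add integrable_continuous_real) (auto intro: continuous_on_subset)
    ultimately show ?case
      using tendsto_add[of "avg (\<lambda>n. f (?v (x n)) * w n)" _ sequentially "avg (\<lambda>n. g (?v (x n)) * w n)"] add.IH
      by (auto simp: distrib_right intro!: continuous_on_add)
  qed
  then have g': "continuous_on UNIV g'" "avg (\<lambda>n. g' (x n) * w n) \<longlonglongrightarrow> mean g' * W" by auto
  have "norm (f (x n) * w n - g' (x n) * w n) \<le> \<epsilon>" for n
  proof -
    have "norm (f (x n) * w n - g' (x n) * w n) = norm (f (x n) - g' (x n)) * norm (w n)"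
      by (simp add: norm_mult[symmetric] left_diff_distrib)
    also have "\<dots> \<le> \<epsilon> * 1"
      using approx[of "x n"] w[of n] \<epsilon> \<eta> by (intro mult_mono) auto
    finally show ?thesis by simp
  qed
  moreover have "norm (mean f * W - mean g' * W) \<le> \<epsilon>"
  proof -
    have cont: "continuous_on {c - 1/2..c + 1/2} f" "continuous_on {c - 1/2..c + 1/2} g'"
      using f(1) g'(1) continuous_on_subset by auto
    then have "mean f - mean g' = integral {c - 1/2..c + 1/2} (\<lambda>t. f t - g' t)"
      unfolding mean_def by (intro integral_diff[symmetric] integrable_continuous_real)
    also have "norm \<dots> \<le> \<eta> * ((c + 1/2) - (c - 1/2))"
      using cont approx by (intro integral_bound continuous_on_diff) auto
    finally have "norm (mean f - mean g') \<le> \<eta>" by simp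
    then have "norm (mean f - mean g') * norm W \<le> \<eta> * norm W"
      by (intro mult_right_mono) auto
    then show ?thesis using \<eta>(3) by (simp add: norm_mult[symmetric] left_diff_distrib)
  qed
  ultimately show "\<exists>v m. avg v \<longlonglongrightarrow> m \<and> (\<forall>n. norm (f (x n) * w n - v n) \<le> \<epsilon>) \<and> norm (mean f * W - m) \<le> \<epsilon>"
    using g'(2) by blast
qed

lemma avg_prod_periodic_complex:
  fixes X :: "nat \<Rightarrow> real ^ 'd::finite" and c :: "'d \<Rightarrow> real" and f :: "'d \<Rightarrow> real \<Rightarrow> complex"
  assumes weyl: "\<And>m. m \<noteq> 0 \<Longrightarrow> avg (\<lambda>n. charac m (X n)) \<longlonglongrightarrow> 0"
    and f: "\<And>i. continuous_on UNIV (f i)" "\<And>i t. f i (t + 1) = f i t" "\<And>i t. norm (f i t) \<le> 1"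
  shows "avg (\<lambda>n. \<Prod>i\<in>UNIV. f i (X n $ i)) \<longlonglongrightarrow> (\<Prod>i\<in>UNIV. integral {c i - 1/2..c i + 1/2} (f i))"
proof -
  define nice where "nice f \<longleftrightarrow> continuous_on UNIV f \<and> (\<forall>t. f (t + 1) = f t) \<and> (\<forall>t. norm (f t) \<le> 1)"
    for f :: "real \<Rightarrow> complex"
  define mean where "mean i f = integral {c i - 1/2..c i + 1/2} f" for i :: 'd and f :: "real \<Rightarrow> complex"
  have nice_e: "nice (\<lambda>t. e (of_int m * t))" for m
  proof -
    have "e (of_int m * (t + 1)) = e (of_int m * t)" for t
    proof -
      have "of_int m * (t + 1) = of_int m * t + real_of_int m" by (simp add: distrib_left)
      then show ?thesis by (simp only: e_add e_of_int[OF Ints_of_int] mult_1_right)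
    qed
    then show ?thesis unfolding nice_def by (auto intro!: continuous_intros)
  qed
  \<comment> \<open>The coordinates outside \<open>S\<close> carry characters, which are traded for arbitrary functions one
    coordinate at a time.\<close>
  have "avg (\<lambda>n. \<Prod>i\<in>UNIV. f i (X n $ i)) \<longlonglongrightarrow> (\<Prod>i\<in>UNIV. mean i (f i))"
    if "finite S" "\<And>i. i \<in> S \<Longrightarrow> nice (f i)" "\<And>i. i \<notin> S \<Longrightarrow> \<exists>m::int. f i = (\<lambda>t. e (of_int m * t))"
    for S f
    using that
  proof (induction S arbitrary: f rule: finite_induct)
    \<comment> \<open>Now every factor is a character, so the product is a single character
      \<open>charac m\<close>; its mean tends to 1 or 0 according to whether \<open>m\<close> is 0,
      as does the product of the integrals.\<close>
    case empty
    then have "\<forall>i. \<exists>m::int. f i = (\<lambda>t. e (of_int m * t))" by auto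
    from choice[OF this] obtain k :: "'d \<Rightarrow> int" where k: "\<And>i. f i = (\<lambda>t. e (of_int (k i) * t))" by blast
    define m where "m = (\<chi> i. k i)"
    have prod: "(\<Prod>i\<in>UNIV. f i (X n $ i)) = charac m (X n)" for n
      by (simp add: charac_prod k m_def)
    have mean: "mean i (f i) = of_bool (m $ i = 0)" for i
      unfolding k mean_def integral_e by (simp add: m_def)
    show ?case
    proof (cases "m = 0")
      case True
      then show ?thesis unfolding prod mean using avg_const[of 1] by (simp add: charac_def)
    next
      case False
      then obtain i where "m $ i \<noteq> 0" by (auto simp: vec_eq_iff)
      then have zero: "(\<Prod>i\<in>UNIV. mean i (f i)) = 0"
        unfolding mean by (intro prod_zero) auto
      show ?thesis unfolding prod zero by (rule weyl[OF False])
    qed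
  next
    case (insert i S)
    have nice_f: "nice (f j)" for j
      using insert.prems[of j] nice_e by (cases "j \<in> insert i S") (metis, metis)
    define w where "w n = (\<Prod>j\<in>UNIV - {i}. f j (X n $ j))" for n
    define W where "W = (\<Prod>j\<in>UNIV - {i}. mean j (f j))"
    \<comment> \<open>With \<open>g\<close> a character in coordinate \<open>i\<close>, the
      induction hypothesis supplies the limits required for the weight \<open>w\<close>.\<close>
    have split: "(\<Prod>j\<in>UNIV. (f(i := g)) j (X n $ j)) = g (X n $ i) * w n" for g n
      by (subst prod.remove[of _ i]) (auto simp: w_def intro!: prod.cong)
    have split': "(\<Prod>j\<in>UNIV. mean j ((f(i := g)) j)) = mean i g * W" for g
      by (subst prod.remove[of _ i]) (auto simp: W_def intro!: prod.cong)
    have "avg (\<lambda>n. f i (X n $ i) * w n) \<longlonglongrightarrow> mean i (f i) * W"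
      unfolding mean_def
    proof (rule avg_periodic_weighted)
      show "norm (w n) \<le> 1" for n
        unfolding w_def prod_norm[symmetric] using nice_f by (intro prod_le_1) (auto simp: nice_def)
      show "avg (\<lambda>n. e (of_int m * X n $ i) * w n) \<longlonglongrightarrow>
        integral {c i - 1/2..c i + 1/2} (\<lambda>t. e (of_int m * t)) * W" for m :: int
      proof -
        have "avg (\<lambda>n. \<Prod>j\<in>UNIV. (f(i := (\<lambda>t. e (of_int m * t)))) j (X n $ j))
          \<longlonglongrightarrow> (\<Prod>j\<in>UNIV. mean j ((f(i := (\<lambda>t. e (of_int m * t)))) j))"
          using insert by (intro insert.IH) auto
        from this[unfolded split split'] show ?thesis unfolding mean_def .
      qed
    qed (use nice_f in \<open>auto simp: nice_def\<close>)
    then show ?case using split[of "f i"] split'[of "f i"] by simp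
  qed
  from this[of UNIV f] f show ?thesis by (auto simp: nice_def mean_def)
qed

lemma avg_prod_periodic:
  fixes X :: "nat \<Rightarrow> real ^ 'd::finite" and c :: "'d \<Rightarrow> real" and f :: "'d \<Rightarrow> real \<Rightarrow> real"
  assumes weyl: "\<And>m. m \<noteq> 0 \<Longrightarrow> avg (\<lambda>n. charac m (X n)) \<longlonglongrightarrow> 0"
    and f: "\<And>i. continuous_on UNIV (f i)" "\<And>i t. f i (t + 1) = f i t" "\<And>i t. \<bar>f i t\<bar> \<le> 1"
  shows "(\<lambda>N. (\<Sum>n=1..N. \<Prod>i\<in>UNIV. f i (X n $ i)) / real N)
    \<longlonglongrightarrow> (\<Prod>i\<in>UNIV. integral {c i - 1/2..c i + 1/2} (f i))"
proof -
  have "integral {c i - 1/2..c i + 1/2} (\<lambda>t. complex_of_real (f i t))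
      = of_real (integral {c i - 1/2..c i + 1/2} (f i))" for i
    using integral_linear[OF integrable_continuous_real bounded_linear_of_real, of "c i - 1/2" "c i + 1/2" "f i"]
      continuous_on_subset[OF f(1)[of i]] by (simp add: o_def)
  moreover have "avg (\<lambda>n. \<Prod>i\<in>UNIV. complex_of_real (f i (X n $ i)))
      \<longlonglongrightarrow> (\<Prod>i\<in>UNIV. integral {c i - 1/2..c i + 1/2} (\<lambda>t. complex_of_real (f i t)))"
    by (rule avg_prod_periodic_complex[OF weyl]) (use f in \<open>auto intro!: continuous_intros\<close>)
  moreover have "avg (\<lambda>n. \<Prod>i\<in>UNIV. complex_of_real (f i (X n $ i)))
      = (\<lambda>N. complex_of_real ((\<Sum>n=1..N. \<Prod>i\<in>UNIV. f i (X n $ i)) / real N))"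
    by (rule ext) (simp add: avg_def)
  ultimately show ?thesis
    by (simp only: of_real_prod[symmetric] tendsto_of_real_iff)
qed

section \<open>Trapezoidal bump functions on the circle\<close>

text \<open>The distance to the integers makes this 1-periodic. For \<open>\<delta> > 0\<close> the
  graph is a trapezoid around \<open>c\<close>: 1 up to distance \<open>\<rho> - \<delta>\<close>, 0
  from distance \<open>\<rho>\<close> on, linear in between.\<close>

definition bump :: "real \<Rightarrow> real \<Rightarrow> real \<Rightarrow> real \<Rightarrow> real" where
  "bump c \<rho> \<delta> t = max 0 (min 1 ((\<rho> - infdist (t - c) \<int>) / \<delta>))"

lemma infdist_Ints: "infdist t \<int> = \<bar>t - of_int (round t)\<bar>" for t :: real
proof (rule antisym)
  show "infdist t \<int> \<le> \<bar>t - of_int (round t)\<bar>"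
    using infdist_le[of "of_int (round t)" \<int> t] by (simp add: dist_real_def)
  have "\<bar>t - of_int (round t)\<bar> \<le> dist t a" if "a \<in> \<int>" for a
    using that round_diff_minimal[of t] by (auto elim!: Ints_cases simp: dist_real_def)
  then show "\<bar>t - of_int (round t)\<bar> \<le> infdist t \<int>"
    by (subst infdist_notempty) (auto intro!: cINF_greatest)
qed

lemma infdist_Ints_le: "infdist t \<int> \<le> \<bar>t - of_int k\<bar>" for t :: real
  unfolding infdist_Ints by (rule round_diff_minimal)

lemma infdist_Ints_small:
  fixes t :: real
  assumes "\<bar>t\<bar> \<le> 1/2"
  shows "infdist t \<int> = \<bar>t\<bar>"
proof (rule antisym)
  show "infdist t \<int> \<le> \<bar>t\<bar>" using infdist_Ints_le[of t 0] by simp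
  show "\<bar>t\<bar> \<le> infdist t \<int>"
  proof (cases "round t = 0")
    case False
    then have "\<bar>round t\<bar> \<ge> 1" by linarith
    then have "\<bar>real_of_int (round t)\<bar> \<ge> 1" by linarith
    then show ?thesis unfolding infdist_Ints using assms by linarith
  qed (simp add: infdist_Ints)
qed

lemma infdist_Ints_add_1: "infdist (t + 1) \<int> = infdist t \<int>" for t :: real
proof -
  have "round (t + 1) = round t + 1"
    unfolding round_def by (metis add.commute add.left_commute floor_add_int of_int_1)
  then show ?thesis by (simp add: infdist_Ints)
qed

lemma bump_01: "0 \<le> bump c \<rho> \<delta> t" "bump c \<rho> \<delta> t \<le> 1"
  by (simp_all add: bump_def)

lemma bump_periodic: "bump c \<rho> \<delta> (t + 1) = bump c \<rho> \<delta> t"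
  using infdist_Ints_add_1[of "t - c"] by (simp add: bump_def algebra_simps)

lemma continuous_on_bump: "\<delta> \<noteq> 0 \<Longrightarrow> continuous_on A (bump c \<rho> \<delta>)"
  unfolding bump_def by (intro continuous_intros) auto

lemma bump_eq_1: "\<delta> > 0 \<Longrightarrow> infdist (t - c) \<int> \<le> \<rho> - \<delta> \<Longrightarrow> bump c \<rho> \<delta> t = 1"
  by (simp add: bump_def field_simps)

lemma bump_eq_0: "\<delta> > 0 \<Longrightarrow> infdist (t - c) \<int> \<ge> \<rho> \<Longrightarrow> bump c \<rho> \<delta> t = 0"
  by (simp add: bump_def field_simps)

lemma has_integral_indicator_Icc:
  fixes c \<rho> :: real
  assumes "0 \<le> \<rho>" "\<rho> \<le> 1/2"
  shows "((\<lambda>t. if t \<in> {c - \<rho>..c + \<rho>} then 1 else 0) has_integral 2 * \<rho>) {c - 1/2..c + 1/2}"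
proof (rule has_integral_on_superset)
  have "((\<lambda>t. 1 :: real) has_integral 2 * \<rho>) {c - \<rho>..c + \<rho>}"
    using has_integral_const_real[of "1 :: real" "c - \<rho>" "c + \<rho>"] assms by simp
  then show "((\<lambda>t. if t \<in> {c - \<rho>..c + \<rho>} then 1 else 0 :: real) has_integral 2 * \<rho>) {c - \<rho>..c + \<rho>}"
    by (rule has_integral_eq[rotated]) simp
qed (use assms in auto)

text \<open>On the period centred at \<open>c\<close> the distance of \<open>t - c\<close> to the
  integers is \<open>\<bar>t - c\<bar>\<close>, so the bump lies below the indicator of the interval
  of radius \<open>\<rho>\<close>.\<close>

lemma integral_bump_le:
  assumes "\<delta> > 0" "0 \<le> \<rho>" "\<rho> \<le> 1/2"
  shows "integral {c - 1/2..c + 1/2} (bump c \<rho> \<delta>) \<le> 2 * \<rho>"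
proof (rule has_integral_le[OF integrable_integral has_integral_indicator_Icc[of \<rho> c]])
  show "bump c \<rho> \<delta> integrable_on {c - 1/2..c + 1/2}"
    using assms by (intro integrable_continuous_real continuous_on_bump) auto
  show "bump c \<rho> \<delta> t \<le> (if t \<in> {c - \<rho>..c + \<rho>} then 1 else 0)" if "t \<in> {c - 1/2..c + 1/2}" for t
  proof (cases "t \<in> {c - \<rho>..c + \<rho>}")
    case False
    have "\<bar>t - c\<bar> \<le> 1/2" using that unfolding atLeastAtMost_iff by linarith
    then have "infdist (t - c) \<int> \<ge> \<rho>" using False infdist_Ints_small[of "t - c"] by auto
    then show ?thesis using assms(1) by (simp add: bump_eq_0)
  qed (simp add: bump_01)
qed (use assms in auto)

text \<open>The bump lies above the indicator of the interval of radius
  \<open>\<rho> - \<delta>\<close>. The maximum with 0 keeps the bound nonnegative, so that it can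
  be multiplied over the coordinates.\<close>

lemma integral_bump_ge:
  assumes "\<delta> > 0" "\<rho> \<le> 1/2"
  shows "max 0 (2 * (\<rho> - \<delta>)) \<le> integral {c - 1/2..c + 1/2} (bump c \<rho> \<delta>)"
proof -
  have int: "bump c \<rho> \<delta> integrable_on {c - 1/2..c + 1/2}"
    using assms by (intro integrable_continuous_real continuous_on_bump) auto
  have "0 \<le> integral {c - 1/2..c + 1/2} (bump c \<rho> \<delta>)"
    by (intro integral_nonneg int bump_01)
  moreover have "2 * (\<rho> - \<delta>) \<le> integral {c - 1/2..c + 1/2} (bump c \<rho> \<delta>)" if "\<delta> \<le> \<rho>"
  proof (rule has_integral_le[OF has_integral_indicator_Icc[of "\<rho> - \<delta>" c] integrable_integral[OF int]])
    show "(if t \<in> {c - (\<rho> - \<delta>)..c + (\<rho> - \<delta>)} then 1 else 0) \<le> bump c \<rho> \<delta> t"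
      if "t \<in> {c - 1/2..c + 1/2}" for t
    proof (cases "t \<in> {c - (\<rho> - \<delta>)..c + (\<rho> - \<delta>)}")
      case True
      then have "\<bar>t - c\<bar> \<le> \<rho> - \<delta>" by (simp add: abs_le_iff)
      then show ?thesis using assms(1) infdist_Ints_le[of "t - c" 0] by (simp add: bump_eq_1)
    next
      case False
      then show ?thesis by (simp only: if_False bump_01)
    qed
  qed (use assms that in auto)
  ultimately show ?thesis by (cases "\<delta> \<le> \<rho>") auto
qed

text \<open>The indicator of the box lies between two products of bumps, of radii \<open>r i\<close>
  and \<open>r i + \<delta>\<close>. The averages of both converge, and their limits tend to the
  volume as \<open>\<delta>\<close> tends to 0.\<close>

theorem Weyl_criterion:
  fixes X :: "nat \<Rightarrow> real ^ 'd::finite"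
  assumes weyl: "\<And>m. m \<noteq> 0 \<Longrightarrow> avg (\<lambda>n. charac m (X n)) \<longlonglongrightarrow> 0"
  shows "uniformly_distributed_mod_1 X"
  unfolding uniformly_distributed_mod_1_def
proof (intro allI impI)
  fix a b :: "real ^ 'd"
  assume ab: "\<forall>i. 0 \<le> a $ i \<and> a $ i < b $ i \<and> b $ i < 1"
  define c where "c i = (a $ i + b $ i) / 2" for i
  define r where "r i = (b $ i - a $ i) / 2" for i
  have r: "0 < r i" "r i < 1/2" for i
    using ab[rule_format, of i] by (simp_all add: r_def)
  have vol: "b $ i - a $ i = 2 * r i" for i by (simp add: r_def)
  define K where "K N = {n \<in> {1..N}. (\<chi> i. frac (X n $ i)) \<in> cbox a b}" for N
  have K: "n \<in> K N \<longleftrightarrow> n \<in> {1..N} \<and> (\<forall>i. a $ i \<le> frac (X n $ i) \<and> frac (X n $ i) \<le> b $ i)" for n N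
    by (simp add: K_def mem_box_cart)
  define M where "M s \<delta> N = (\<Sum>n=1..N. \<Prod>i\<in>UNIV. bump (c i) (r i + s) \<delta> (X n $ i)) / real N" for s \<delta> N
  have M_lim: "M s \<delta> \<longlonglongrightarrow> (\<Prod>i\<in>UNIV. integral {c i - 1/2..c i + 1/2} (bump (c i) (r i + s) \<delta>))"
    if "\<delta> > 0" for s \<delta>
    unfolding M_def
    by (rule avg_prod_periodic[OF weyl]) (use that in \<open>auto simp: bump_periodic bump_01 abs_le_iff
      intro!: continuous_on_bump order_trans[OF _ bump_01(1)]\<close>)
  have card_eq: "real (card (K N)) = (\<Sum>n=1..N. of_bool (n \<in> K N))" for N
  proof -
    have "(\<Sum>n=1..N. of_bool (n \<in> K N)) = real (card ({1..N} \<inter> {n. n \<in> K N}))"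
      by (simp add: of_bool_def sum.If_cases)
    moreover have "{1..N} \<inter> {n. n \<in> K N} = K N" by (auto simp: K_def)
    ultimately show ?thesis by simp
  qed
  have upper: "real (card (K N)) / real N \<le> M \<delta> \<delta> N" if \<delta>: "\<delta> > 0" for \<delta> N
    unfolding M_def card_eq
  proof (intro divide_right_mono sum_mono)
    fix n
    have "(\<Prod>i\<in>UNIV. bump (c i) (r i + \<delta>) \<delta> (X n $ i)) = 1" if n: "n \<in> K N"
    proof (intro prod.neutral ballI bump_eq_1)
      fix i
      have "a $ i \<le> frac (X n $ i)" "frac (X n $ i) \<le> b $ i" using n[unfolded K] by auto
      then have "\<bar>frac (X n $ i) - c i\<bar> \<le> r i"
        by (intro abs_leI; simp add: c_def r_def field_simps)
      then show "infdist (X n $ i - c i) \<int> \<le> r i + \<delta> - \<delta>"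
        using infdist_Ints_le[of "X n $ i - c i" "\<lfloor>X n $ i\<rfloor>"] by (simp add: frac_def algebra_simps)
    qed (rule \<delta>)
    then show "of_bool (n \<in> K N) \<le> (\<Prod>i\<in>UNIV. bump (c i) (r i + \<delta>) \<delta> (X n $ i))"
      by (auto intro: prod_nonneg bump_01)
  qed simp
  have lower: "M 0 \<delta> N \<le> real (card (K N)) / real N" if "\<delta> > 0" for \<delta> N
    unfolding M_def card_eq
  proof (intro divide_right_mono sum_mono)
    fix n assume nN: "n \<in> {1..N}"
    show "(\<Prod>i\<in>UNIV. bump (c i) (r i + 0) \<delta> (X n $ i)) \<le> of_bool (n \<in> K N)"
    proof (cases "n \<in> K N")
      case True
      then show ?thesis by (auto intro!: prod_le_1 simp: bump_01)
    next
      case False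
      then obtain i where i: "\<not> (a $ i \<le> frac (X n $ i) \<and> frac (X n $ i) \<le> b $ i)"
        using nN unfolding K by auto
      have "bump (c i) (r i + 0) \<delta> (X n $ i) = 0"
      \<comment> \<open>Otherwise \<open>X n $ i\<close> minus its nearest translate
        \<open>k\<close> lies strictly between \<open>a $ i\<close> and \<open>b $ i\<close>, hence
        within \<open>[0,1)\<close>, and so is the fractional part.\<close>
      proof (rule bump_eq_0[OF that], rule ccontr)
        define k where "k = round (X n $ i - c i)"
        assume "\<not> r i + 0 \<le> infdist (X n $ i - c i) \<int>"
        then have "\<bar>X n $ i - c i - of_int k\<bar> < r i" by (simp add: infdist_Ints k_def)
        then have *: "a $ i < X n $ i - of_int k" "X n $ i - of_int k < b $ i"
          unfolding c_def r_def abs_less_iff by (simp_all add: field_simps)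
        then have "frac (X n $ i) = X n $ i - of_int k"
          using ab[rule_format, of i] by (subst frac_unique_iff) auto
        then show False using i * by simp
      qed
      then have "(\<Prod>i\<in>UNIV. bump (c i) (r i + 0) \<delta> (X n $ i)) = 0"
        by (intro prod_zero) auto
      then show ?thesis by (simp only: of_bool_def if_not_P[OF False] order_refl)
    qed
  qed simp
  have "(\<lambda>N. real (card (K N)) / real N) \<longlonglongrightarrow> (\<Prod>i\<in>UNIV. 2 * r i)"
  proof (rule order_tendstoI)
    fix y assume y: "y < (\<Prod>i\<in>UNIV. 2 * r i)"
    \<comment> \<open>First \<open>\<delta>\<close> is fixed so small that the lower bound for the
      integrals still exceeds \<open>y\<close>; only then does \<open>N\<close> grow.\<close>
    have "((\<lambda>\<delta>. \<Prod>i\<in>UNIV. max 0 (2 * (r i - \<delta>))) \<longlongrightarrow> (\<Prod>i\<in>UNIV. max 0 (2 * (r i - 0)))) (at_right 0)"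
      by (intro tendsto_intros)
    moreover have "(\<Prod>i\<in>UNIV. max 0 (2 * (r i - 0))) = (\<Prod>i\<in>UNIV. 2 * r i)"
      using r by (intro prod.cong) (auto simp: max_def less_imp_le)
    ultimately have "\<forall>\<^sub>F \<delta> in at_right 0. y < (\<Prod>i\<in>UNIV. max 0 (2 * (r i - \<delta>))) \<and> \<delta> > 0"
      using y by (intro eventually_conj eventually_at_right_less) (auto intro: order_tendstoD)
    then obtain \<delta> where \<delta>: "y < (\<Prod>i\<in>UNIV. max 0 (2 * (r i - \<delta>)))" "\<delta> > 0"
      using eventually_happens'[OF trivial_limit_at_right_real] by blast
    note \<delta>(1)
    also have "(\<Prod>i\<in>UNIV. max 0 (2 * (r i - \<delta>))) \<le> (\<Prod>i\<in>UNIV. integral {c i - 1/2..c i + 1/2} (bump (c i) (r i + 0) \<delta>))"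
      using integral_bump_ge[OF \<delta>(2), of "r i" "c i" for i] r
      by (intro prod_mono) (auto simp: less_imp_le)
    finally have "\<forall>\<^sub>F N in sequentially. y < M 0 \<delta> N"
      by (rule order_tendstoD(1)[OF M_lim[OF \<delta>(2)]])
    then show "\<forall>\<^sub>F N in sequentially. y < real (card (K N)) / real N"
      by eventually_elim (use lower[OF \<delta>(2)] in \<open>auto intro: less_le_trans\<close>)
  next
    fix y assume y: "(\<Prod>i\<in>UNIV. 2 * r i) < y"
    have "((\<lambda>\<delta>. \<Prod>i\<in>UNIV. 2 * (r i + \<delta>)) \<longlongrightarrow> (\<Prod>i\<in>UNIV. 2 * (r i + 0))) (at_right 0)"
      by (intro tendsto_intros)
    then have "\<forall>\<^sub>F \<delta> in at_right 0. (\<Prod>i\<in>UNIV. 2 * (r i + \<delta>)) < y"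
      using y by (intro order_tendstoD) auto
    \<comment> \<open>The widened radius \<open>r i + \<delta>\<close> has to stay within half a
      period for the integral estimates.\<close>
    moreover have "\<forall>\<^sub>F \<delta> in at_right 0. \<delta> < 1/2 - r i" for i
      using r by (intro order_tendstoD(2)[OF tendsto_ident_at]) simp
    then have "\<forall>\<^sub>F \<delta> in at_right 0. \<forall>i. \<delta> < 1/2 - r i"
      by (rule eventually_all_finite)
    ultimately have "\<forall>\<^sub>F \<delta> in at_right 0. (\<Prod>i\<in>UNIV. 2 * (r i + \<delta>)) < y \<and> (\<forall>i. \<delta> < 1/2 - r i) \<and> \<delta> > 0"
      by (intro eventually_conj eventually_at_right_less)
    then obtain \<delta> where \<delta>: "(\<Prod>i\<in>UNIV. 2 * (r i + \<delta>)) < y" "\<And>i. \<delta> < 1/2 - r i" "\<delta> > 0"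
      using eventually_happens'[OF trivial_limit_at_right_real] by blast
    have "(\<Prod>i\<in>UNIV. integral {c i - 1/2..c i + 1/2} (bump (c i) (r i + \<delta>) \<delta>)) \<le> (\<Prod>i\<in>UNIV. 2 * (r i + \<delta>))"
    proof (intro prod_mono conjI)
      fix i
      have *: "r i + \<delta> \<le> 1/2" "0 \<le> r i + \<delta>" using \<delta>(2)[of i] \<delta>(3) r(1)[of i] by linarith+
      show "0 \<le> integral {c i - 1/2..c i + 1/2} (bump (c i) (r i + \<delta>) \<delta>)"
        using integral_bump_ge[OF \<delta>(3) *(1), of "c i"] by simp
      show "integral {c i - 1/2..c i + 1/2} (bump (c i) (r i + \<delta>) \<delta>) \<le> 2 * (r i + \<delta>)"
        by (rule integral_bump_le[OF \<delta>(3) *(2,1)])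
    qed
    also note \<delta>(1)
    finally have "\<forall>\<^sub>F N in sequentially. M \<delta> \<delta> N < y"
      by (rule order_tendstoD(2)[OF M_lim[OF \<delta>(3)]])
    then show "\<forall>\<^sub>F N in sequentially. real (card (K N)) / real N < y"
      by eventually_elim (use upper[OF \<delta>(3)] in \<open>auto intro: le_less_trans\<close>)
  qed
  then show "(\<lambda>n. real (card {k \<in> {1..n}. (\<chi> i. frac (X k $ i)) \<in> cbox a b}) / real n)
    \<longlonglongrightarrow> (\<Prod>i\<in>UNIV. b $ i - a $ i)"
    unfolding K_def vol .
qed

theorem theorem4p10:
  fixes F :: "'d::finite \<Rightarrow> real ^ 'v::finite \<Rightarrow> real"
    and \<beta> :: "'d \<Rightarrow> 'v \<Rightarrow> real"
    and P :: "'d \<Rightarrow> real poly"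
    and Q :: "'d \<Rightarrow> 'v \<Rightarrow> real poly"
  assumes "\<And>i. continuous_on UNIV (F i)"
    and "\<And>i j. \<beta> i j \<noteq> 0"
    and "\<And>i j x. F i (x + axis j (\<beta> i j)) = F i x"
    and "\<And>i. coeff (P i) 0 = 0"
    and "\<And>i j. coeff (Q i j) 0 = 0"
    and "totally_Q_independent P (\<lambda>i j. smult (1 / \<beta> i j) (Q i j))"
  shows "uniformly_distributed_mod_1
    (\<lambda>n. \<chi> i. poly (P i) (real n) + F i (\<chi> j. poly (Q i j) (real n)))"
  by (rule Weyl_criterion) (rule perturbed_weyl_sum[OF assms])

end
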